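(* Let $q$ be a prime power, $N\ge 3$, $1\le k\le N-1$, and $1 \le \ell \le (q^N-1)/(q-1)$ integers, and let $X$ be an $N$-dimensional $\mathbb{F}_q$-vector space. Then $$\hat{\delta}_q(N,k,\ell) = \binom{\frac{q^N-q^k}{q-1}}{\ell}\Big/\binom{\frac{q^N-1}{q-1}}{\ell}.$$
   Context: $\mathcal{G}_q(X,j)$ denotes the set of $j$-dimensional $\mathbb{F}_q$-subspaces of $X$. A point set is a nonempty subset $P\subseteq\mathcal{G}_q(X,1)$; a subspace $V\le X$ distinguishes $P$ if no element of $P$ is contained in $V$. $\delta_q(X,k,P)$ is the number of $V\in\mathcal{G}_q(X,k)$ distinguishing $P$, divided by $|\mathcal{G}_q(X,k)|$. $\hat\delta_q(N,k,\ell)$ is the average of $\delta_q(X,k,P)$ over all point sets $P\subseteq\mathcal{G}_q(X,1)$ with $|P|=\ell$ (i.e. the sum of $\delta_q(X,k,P)$ over these $P$, divided by $\binom{(q^N-1)/(q-1)}{\ell}$). *)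

theory Defs
  imports Complex_Main "HOL-Library.Cardinality"
    "HOL-Number_Theory.Prime_Powers"
begin

text \<open>
  The space \<open>X\<close> is a subspace (possibly all) of a vector space on the type \<open>'b\<close> with scalar
  multiplication \<open>scale\<close>; the parameter \<open>q\<close> is the cardinality of the scalar type \<open>'a\<close>.
  The library's \<open>dim\<close> is \<open>0\<close> on infinite-dimensional spaces, so \<open>grassmannian scale X j\<close> is the
  intended set whenever \<open>X\<close> is finite-dimensional.
\<close>

definition grassmannian ::
    "('a::field \<Rightarrow> 'b::ab_group_add \<Rightarrow> 'b) \<Rightarrow> 'b set \<Rightarrow> nat \<Rightarrow> 'b set set" where
  "grassmannian scale X j =
     {V. module.subspace scale V \<and> V \<subseteq> X \<and> vector_space.dim scale V = j}"

definition point_set ::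
    "('a::field \<Rightarrow> 'b::ab_group_add \<Rightarrow> 'b) \<Rightarrow> 'b set \<Rightarrow> 'b set set \<Rightarrow> bool" where
  "point_set scale X P \<longleftrightarrow> P \<noteq> {} \<and> P \<subseteq> grassmannian scale X 1"

definition distinguishes :: "'b set \<Rightarrow> 'b set set \<Rightarrow> bool" where
  "distinguishes V P \<longleftrightarrow> (\<forall>p\<in>P. \<not> p \<subseteq> V)"

definition delta ::
    "('a::field \<Rightarrow> 'b::ab_group_add \<Rightarrow> 'b) \<Rightarrow> 'b set \<Rightarrow> nat \<Rightarrow> 'b set set \<Rightarrow> real" where
  "delta scale X k P =
     real (card {V \<in> grassmannian scale X k. distinguishes V P}) /
     real (card (grassmannian scale X k))"

definition avg_delta ::
    "('a::field \<Rightarrow> 'b::ab_group_add \<Rightarrow> 'b) \<Rightarrow> 'b set \<Rightarrow> nat \<Rightarrow> nat \<Rightarrow> real" where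
  "avg_delta scale X k l =
     (\<Sum>P | point_set scale X P \<and> card P = l. delta scale X k P) /
     real (card {P. point_set scale X P \<and> card P = l})"

end

theory Submission imports Defs begin

text \<open>
  Double counting: summing over the \<open>l\<close>-sets \<open>P\<close> of points the number of \<open>k\<close>-subspaces that
  distinguish \<open>P\<close> amounts to summing over the \<open>k\<close>-subspaces \<open>V\<close> the number of \<open>l\<close>-sets of points
  outside \<open>V\<close>. The latter number is the same for all \<open>V\<close>, since the number of points of a space
  depends only on its dimension.
\<close>

context vector_space
begin

text \<open>Each added basis vector \<open>b\<close> multiplies the size by \<open>CARD('a)\<close>:
  the map \<open>(c, v)\<close> to \<open>scale c b + v\<close> is a bijection from
  \<open>UNIV \<times> span B\<close> onto \<open>span (insert b B)\<close>. Over an infinite field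
  and for nonempty \<open>B\<close>, both sides are 0.\<close>

lemma card_span_independent:
  assumes "finite B" and "independent B"
  shows "card (span B) = CARD('a) ^ card B"
  using assms
proof (induction B rule: finite_induct)
  case empty
  then show ?case by simp
next
  case (insert b B)
  then have b: "b \<notin> span B" and B: "independent B"
    by (simp_all add: independent_insert)
  let ?f = "\<lambda>(c, v). scale c b + v"
  have "inj_on ?f (UNIV \<times> span B)"
  proof (rule inj_onI, clarify)
    fix c d v w
    assume v: "v \<in> span B" and w: "w \<in> span B" and eq: "scale c b + v = scale d b + w"
    then have "scale (c - d) b = w - v"
      by (simp add: scale_left_diff_distrib algebra_simps)
    then have "scale (c - d) b \<in> span B"
      using v w by (simp add: span_diff)
    \<comment> \<open>Otherwise scaling by \<open>inverse (c - d)\<close> would put \<open>b\<close>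
      into \<open>span B\<close>.\<close>
    with b have "c = d"
      using span_scale[of "scale (c - d) b" B "inverse (c - d)"] by (cases "c = d") auto
    with eq show "c = d \<and> v = w" by simp
  qed
  moreover have "?f ` (UNIV \<times> span B) = span (insert b B)"
  proof (intro equalityI subsetI)
    fix x
    assume "x \<in> ?f ` (UNIV \<times> span B)"
    then show "x \<in> span (insert b B)"
      using span_mono[of B "insert b B"] by (auto intro!: span_add span_scale intro: span_base)
  next
    fix x
    assume "x \<in> span (insert b B)"
    then obtain c where "x - scale c b \<in> span B"
      by (auto simp: span_breakdown_eq)
    then show "x \<in> ?f ` (UNIV \<times> span B)"
      by (intro image_eqI[where x = "(c, x - scale c b)"]) auto
  qed
  ultimately have "card (span (insert b B)) = CARD('a) * card (span B)"
    by (metis card_image card_cartesian_product)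
  with insert.IH[OF B] insert.hyps show ?case by simp
qed

text \<open>Positive dimension forces a finite basis, because \<open>dim\<close> defaults to 0 on
  infinite-dimensional spaces.\<close>

lemma card_subspace:
  assumes "subspace V" and "dim V > 0"
  shows "card V = CARD('a) ^ dim V"
proof -
  obtain B where B: "B \<subseteq> V" "independent B" "V \<subseteq> span B" "card B = dim V"
    using basis_exists by blast
  moreover have "finite B" using B(4) assms(2) by (metis card.infinite less_irrefl)
  moreover have "span B = V" using B assms(1) span_minimal by blast
  ultimately show ?thesis using card_span_independent by metis
qed

text \<open>The line \<open>span {v}\<close> lies in \<open>p\<close> and has equally many elements.
  Hence distinct points share only the zero vector.\<close>

lemma point_eq_span:
  assumes fin: "finite (UNIV :: 'a set)"
    and p: "p \<in> grassmannian scale V 1" and v: "v \<in> p" "v \<noteq> 0"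
  shows "p = span {v}"
proof -
  have sub: "subspace p" and dim: "dim p = 1"
    using p by (auto simp: grassmannian_def)
  have card: "card p = CARD('a)"
    using card_subspace[OF sub] dim by simp
  then have "finite p"
    using fin by (metis card.infinite card_eq_0_iff UNIV_not_empty)
  moreover have "span {v} \<subseteq> p"
    using sub v by (simp add: span_minimal)
  moreover have "card (span {v}) = card p"
    using card_span_independent[of "{v}"] v card by simp
  ultimately show ?thesis
    by (metis card_subset_eq)
qed

lemma span_singleton_mem_grassmannian:
  assumes "subspace V" and "v \<in> V" and "v \<noteq> 0"
  shows "span {v} \<in> grassmannian scale V 1"
  using assms dim_eq_card_independent[of "{v}"]
  by (simp add: grassmannian_def span_minimal)

text \<open>The sets \<open>p - {0}\<close>, for \<open>p\<close> a point of \<open>V\<close>,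
  partition \<open>V - {0}\<close>, and each has \<open>CARD('a) - 1\<close> elements. The product
  form allows subtracting two point counts before any division.\<close>

lemma card_points_mult:
  assumes fin: "finite (UNIV :: 'a set)" and V: "subspace V" and pos: "dim V > 0"
  shows "card (grassmannian scale V 1) * (CARD('a) - 1) = CARD('a) ^ dim V - 1"
proof -
  let ?G = "grassmannian scale V 1"
  have cV: "card V = CARD('a) ^ dim V" using card_subspace[OF V pos] .
  then have finV: "finite V"
    using fin by (metis card.infinite card_eq_0_iff UNIV_not_empty power_not_zero)
  have "?G \<subseteq> Pow V" by (auto simp: grassmannian_def)
  then have finG: "finite ?G" using finV by (simp add: finite_subset)
  have zero: "0 \<in> p" if "p \<in> ?G" for p
    using that by (auto simp: grassmannian_def subspace_0)
  have cp: "card (p - {0}) = CARD('a) - 1" if "p \<in> ?G" for p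
    using that card_subspace[of p] zero[OF that] by (simp add: grassmannian_def)
  have "(\<Union>p\<in>?G. p - {0}) = V - {0}"
  proof (intro equalityI subsetI)
    fix x
    assume "x \<in> V - {0}"
    then show "x \<in> (\<Union>p\<in>?G. p - {0})"
      using span_singleton_mem_grassmannian[OF V] by (auto intro!: bexI[of _ "span {x}"] span_base)
  qed (auto simp: grassmannian_def)
  moreover have "card (\<Union>p\<in>?G. p - {0}) = (\<Sum>p\<in>?G. card (p - {0}))"
  proof (rule card_UN_disjoint[OF finG])
    show "\<forall>p\<in>?G. finite (p - {0})"
      using finV by (auto simp: grassmannian_def intro: finite_subset)
    show "\<forall>p\<in>?G. \<forall>r\<in>?G. p \<noteq> r \<longrightarrow> (p - {0}) \<inter> (r - {0}) = {}"
      using point_eq_span[OF fin] by blast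
  qed
  ultimately have "card ?G * (CARD('a) - 1) = card (V - {0})"
    using cp by simp
  then show ?thesis
    using cV subspace_0[OF V] by simp
qed

lemma card_points:
  assumes fin: "finite (UNIV :: 'a set)" and "subspace V" and "dim V > 0"
  shows "card (grassmannian scale V 1) = (CARD('a) ^ dim V - 1) div (CARD('a) - 1)"
proof -
  \<comment> \<open>Since 0 and 1 differ, the divisor \<open>CARD('a) - 1\<close> is
    positive.\<close>
  have "card {0, 1 :: 'a} \<le> CARD('a)" using fin by (intro card_mono) auto
  then show ?thesis
    using card_points_mult[OF assms] by (metis card_2_iff diff_is_0_eq nonzero_mult_div_cancel_right
      not_less_eq_eq numeral_2_eq_2 One_nat_def zero_neq_one)
qed

text \<open>Any \<open>k\<close> elements of a basis of \<open>X\<close> span a witness. This keeps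
  the denominator of \<open>delta\<close> away from 0.\<close>

lemma grassmannian_nonempty:
  assumes "subspace X" and "k \<le> dim X"
  shows "grassmannian scale X k \<noteq> {}"
proof -
  obtain B where B: "B \<subseteq> X" "independent B" "card B = dim X"
    using basis_exists[of X] by metis
  obtain C where C: "C \<subseteq> B" "card C = k"
    using assms(2) B(3) by (metis obtain_subset_with_card_n)
  then have "independent C" using B(2) independent_mono by blast
  then have "dim (span C) = k" using C dim_span_eq_card_independent by blast
  moreover have "span C \<subseteq> X" using B C assms(1) by (meson span_minimal subset_trans)
  ultimately show ?thesis by (auto simp: grassmannian_def)
qed

end

theorem theorem4p3:
  fixes scale :: "'a::{field,finite} \<Rightarrow> 'b::ab_group_add \<Rightarrow> 'b"
    and X :: "'b set" and q N k l :: nat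
  assumes "primepow q" and "CARD('a) = q"
    and "vector_space scale"
    and "module.subspace scale X" and "vector_space.dim scale X = N"
    and "N \<ge> 3" and "1 \<le> k" and "k \<le> N - 1"
    and "1 \<le> l" and "l \<le> (q ^ N - 1) div (q - 1)"
  shows "avg_delta scale X k l =
    real (((q ^ N - q ^ k) div (q - 1)) choose l) / real (((q ^ N - 1) div (q - 1)) choose l)"
proof -
  interpret vector_space scale by fact
  note q = \<open>CARD('a) = q\<close>
  have X: "subspace X" and N: "dim X = N" and posX: "dim X > 0"
    using assms by auto
  have q1: "q > 1" using primepow_gt_Suc_0[OF \<open>primepow q\<close>] by simp
  have "card X = q ^ N" using card_subspace[OF X posX] q N by simp
  then have "finite X" using q1 by (intro card_ge_0_finite) simp
  then have fin: "finite (grassmannian scale X j)" for j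
    by (rule rev_finite_subset[OF finite_Pow_iff[THEN iffD2]]) (auto simp: grassmannian_def)
  let ?G = "grassmannian scale X k"
  let ?A = "grassmannian scale X 1"
  let ?m = "(q ^ N - q ^ k) div (q - 1)"
  let ?S = "{P. P \<subseteq> ?A \<and> card P = l}"
  \<comment> \<open>A set of size \<open>l \<ge> 1\<close> is automatically nonempty.\<close>
  have S: "{P. point_set scale X P \<and> card P = l} = ?S"
    using \<open>1 \<le> l\<close> by (auto simp: point_set_def)
  have finS: "finite ?S" using fin by simp
  have cA: "card ?A = (q ^ N - 1) div (q - 1)"
    using card_points[OF _ X posX] q N by simp
  then have cS: "card ?S = ((q ^ N - 1) div (q - 1)) choose l"
    using n_subsets[OF fin, of 1 l] by simp
  have G: "card ?G \<noteq> 0"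
    using grassmannian_nonempty[OF X, of k] N assms fin by simp
  have outside: "card {P \<in> ?S. distinguishes V P} = ?m choose l" if V: "V \<in> ?G" for V
  proof -
    let ?B = "grassmannian scale V 1"
    have sV: "subspace V" and VX: "V \<subseteq> X" and dV: "dim V = k"
      using V by (auto simp: grassmannian_def)
    have BA: "?B \<subseteq> ?A" using VX by (auto simp: grassmannian_def)
    \<comment> \<open>A point of \<open>X\<close> is contained in \<open>V\<close> exactly when it
      is a point of \<open>V\<close>.\<close>
    have "{P \<in> ?S. distinguishes V P} = {P. P \<subseteq> ?A - ?B \<and> card P = l}"
      by (auto simp: distinguishes_def grassmannian_def)
    moreover have "card (?A - ?B) = ?m"
    proof -
      have "card ?B * (q - 1) = q ^ k - 1"
        using card_points_mult[OF _ sV] dV q \<open>1 \<le> k\<close> by simp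
      moreover have "card ?A * (q - 1) = q ^ N - 1"
        using card_points_mult[OF _ X posX] q N by simp
      moreover have "card (?A - ?B) = card ?A - card ?B"
        using BA fin by (meson card_Diff_subset finite_subset)
      \<comment> \<open>Subtraction on naturals is truncated; this bound lets the two ones cancel in
        \<open>(q ^ N - 1) - (q ^ k - 1)\<close>.\<close>
      moreover have "q ^ k \<ge> 1" using q1 by simp
      ultimately have "card (?A - ?B) * (q - 1) = q ^ N - q ^ k"
        by (simp add: diff_mult_distrib)
      then show ?thesis using q1
        by (metis nonzero_mult_div_cancel_right zero_less_diff less_irrefl)
    qed
    ultimately show ?thesis
      using n_subsets[of "?A - ?B" l] fin by simp
  qed
  have "(\<Sum>P\<in>?S. card {V \<in> ?G. distinguishes V P}) = (\<Sum>V\<in>?G. card {P \<in> ?S. distinguishes V P})"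
    \<comment> \<open>Both sides count the pairs \<open>(P, V)\<close> with \<open>V\<close>
      distinguishing \<open>P\<close>; summing the constant 1 turns the cardinalities into double
      sums.\<close>
    using sum.swap_restrict[OF finS fin, of "\<lambda>_ _. 1::nat" k "\<lambda>P V. distinguishes V P"]
    by simp
  also have "\<dots> = card ?G * (?m choose l)"
    using outside by simp
  finally have "(\<Sum>P\<in>?S. real (card {V \<in> ?G. distinguishes V P})) = real (card ?G) * real (?m choose l)"
    by (simp only: flip: of_nat_sum of_nat_mult)
  \<comment> \<open>All summands share the denominator \<open>card ?G\<close>, which cancels against
    the factor just obtained.\<close>
  then have "(\<Sum>P\<in>?S. delta scale X k P) = real (?m choose l)"
    using G by (simp add: delta_def flip: sum_divide_distrib)
  then show ?thesis
    by (simp only: avg_delta_def S cS)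
qed

end
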